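(* Let $n \ge 2$. There exists a constant $c_n > 0$, depending only on $n$, such that the following holds. For every open, bounded domain $\Omega \subset \mathbb{R}^n$ there is $N_0 \in \mathbb{N}$ (depending only on $\Omega$) such that for every $N \ge N_0$ and every decomposition $\Omega = \bigcup_{i=1}^N \Omega_i$ into measurable sets $\Omega_i$ of positive measure with $\Omega_i \cap \Omega_j = \emptyset$ for $i \neq j$, $$\left(\sum_{i=1}^{N}\frac{|\Omega_i|}{|\Omega|}\mathcal{A}(\Omega_i)\right)+\left(\sum_{i=1}^{N}\frac{|\Omega_i|}{|\Omega|}D(\Omega_i)\right) \geq c_n.$$ Moreover, in dimension $n=2$ one can take $c_2 = \frac{1}{60000}$.
   Context: $|\cdot|$ denotes Lebesgue measure. For a measurable set $E \subset \mathbb{R}^n$ of positive finite measure, its Fraenkel asymmetry is $\mathcal{A}(E) := \inf_{B} \frac{|E \triangle B|}{|E|}$, where the infimum ranges over all (Euclidean) balls $B \subset \mathbb{R}^n$ with $|B| = |E|$, and $E \triangle B = (E\setminus B)\cup(B\setminus E)$; one has $0 \le \mathcal{A}(E) \le 2$. For a partition $\Omega = \bigcup_{i=1}^N \Omega_i$, the deviation from the smallest element is $D(\Omega_i) := \frac{|\Omega_i| - \min_{1\le j\le N}|\Omega_j|}{|\Omega_i|} \in [0,1]$. *)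

theory Defs
  imports "HOL-Analysis.Analysis"
begin

abbreviation lmeas :: "'a::euclidean_space set \<Rightarrow> real" where
  "lmeas E \<equiv> measure lebesgue E"

definition fraenkel_asymmetry :: "'a::euclidean_space set \<Rightarrow> real" where
  "fraenkel_asymmetry E =
     Inf { lmeas ((E - B) \<union> (B - E)) / lmeas E | B.
           (\<exists>x r. r > 0 \<and> B = ball x r) \<and> lmeas B = lmeas E }"

definition deviation_min :: "(nat \<Rightarrow> 'a::euclidean_space set) \<Rightarrow> nat \<Rightarrow> nat \<Rightarrow> real" where
  "deviation_min \<Omega> N i =
     (lmeas (\<Omega> i) - Min ((\<lambda>j. lmeas (\<Omega> j)) ` {1..N})) / lmeas (\<Omega> i)"

definition is_partition :: "'a::euclidean_space set \<Rightarrow> nat \<Rightarrow> (nat \<Rightarrow> 'a set) \<Rightarrow> bool" where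
  "is_partition U N \<Omega> \<longleftrightarrow>
     U = (\<Union>i\<in>{1..N}. \<Omega> i) \<and>
     (\<forall>i\<in>{1..N}. \<Omega> i \<in> sets lebesgue \<and> lmeas (\<Omega> i) > 0) \<and>
     (\<forall>i\<in>{1..N}. \<forall>j\<in>{1..N}. i \<noteq> j \<longrightarrow> \<Omega> i \<inter> \<Omega> j = {})"

definition asym_dev_bound :: "'a::euclidean_space itself \<Rightarrow> real \<Rightarrow> bool" where
  "asym_dev_bound _ c \<longleftrightarrow>
     (\<forall>U :: 'a set. open U \<and> bounded U \<longrightarrow>
        (\<exists>N0::nat. \<forall>N \<ge> N0. \<forall>\<Omega>. is_partition U N \<Omega> \<longrightarrow>
           (\<Sum>i=1..N. lmeas (\<Omega> i) / lmeas U * fraenkel_asymmetry (\<Omega> i))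
         + (\<Sum>i=1..N. lmeas (\<Omega> i) / lmeas U * deviation_min \<Omega> N i) \<ge> c))"

end

theory Submission
  imports Defs
begin

text \<open>
  Replace each cell by a nearly optimal ball of the same measure and shrink all these balls to the
  common radius \<open>r\<close> given by the smallest cell. Outside a set \<open>G\<close>, whose measure the two sums
  control, the shrunken balls cover \<open>U\<close> exactly once. Equal balls cannot do this well:
  every ball of radius \<open>7 r / 2\<close> inside \<open>U\<close> contains a ball of radius \<open>r / 20\<close> that is either
  uncovered or covered twice, hence lies in \<open>G\<close>. As \<open>N\<close> grows, \<open>r\<close> tends to \<open>0\<close>, and a
  Vitali covering of most of \<open>U\<close> by balls of radius \<open>7 r / 2\<close> bounds the measure of \<open>G\<close> from below.
\<close>

section \<open>Geometry of equal balls: a hole or an overlap near every point\<close>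

text \<open>Apollonius's median formula, that is, the parallelogram law for \<open>u - w\<close> and
  \<open>u + w\<close>. It turns distances to two centres into the distance to their midpoint, and
  back.\<close>

lemma median_length:
  fixes a b x :: "'a::real_inner"
  shows "(dist x a)\<^sup>2 + (dist x b)\<^sup>2 = 2 * (dist x (midpoint a b))\<^sup>2 + (dist a b)\<^sup>2 / 2"
proof -
  define u where "u = x - midpoint a b"
  define w where "w = (1/2) *\<^sub>R (a - b)"
  have "x - a = u - w" "x - b = u + w" "a - b = 2 *\<^sub>R w"
    by (simp_all add: u_def w_def midpoint_def algebra_simps flip: scaleR_left_distrib)
  then show ?thesis
    unfolding dist_norm u_def[symmetric] power2_norm_eq_inner
    by (simp add: inner_simps inner_commute)
qed

lemma dist_midpoint_le:
  fixes a b y :: "'a::real_normed_vector"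
  shows "2 * dist y (midpoint a b) \<le> dist y a + dist y b"
proof -
  have "2 *\<^sub>R (y - midpoint a b) = (y - a) + (y - b)"
    by (simp add: midpoint_def scaleR_right_diff_distrib scaleR_2)
  then have "norm (2 *\<^sub>R (y - midpoint a b)) \<le> norm (y - a) + norm (y - b)"
    by (metis norm_triangle_ineq)
  then show ?thesis by (simp add: dist_norm)
qed

text \<open>
  Suppose there is no hole. Then a second centre \<open>x j\<close> almost touches a first one \<open>x i\<close>, and a third
  one, \<open>x k\<close>, lies close to the point \<open>p\<close> at distance \<open>1/2\<close> from their midpoint in an orthogonal
  direction. Without a double covering the three centres are pairwise almost \<open>2\<close> apart, so
  \<open>x k\<close> has distance about \<open>sqrt 3\<close> from the midpoint, which exceeds \<open>1/2 + 21/20\<close>.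
\<close>
lemma unit_balls_hole_or_overlap:
  fixes x :: "'i \<Rightarrow> 'a::euclidean_space" and y :: 'a
  assumes dim: "DIM('a) \<ge> 2"
  obtains p where "dist y p \<le> 17/5"
    and "(\<forall>i\<in>I. dist p (x i) \<ge> 21/20) \<or>
         (\<exists>i\<in>I. \<exists>j\<in>I. i \<noteq> j \<and> dist p (x i) \<le> 19/20 \<and> dist p (x j) \<le> 19/20)"
proof -
  have False if neg: "\<And>p. dist y p \<le> 17/5 \<Longrightarrow> (\<exists>i\<in>I. dist p (x i) < 21/20) \<and>
      (\<forall>i\<in>I. \<forall>j\<in>I. i \<noteq> j \<longrightarrow> dist p (x i) > 19/20 \<or> dist p (x j) > 19/20)"
  proof -
    \<comment> \<open>Test the assumption at the midpoint of the two centres: the bound 34/5 = 2 *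
      17/5 keeps it within range of \<open>y\<close>, and as it is not within 19/20 of both, the
      centres are at least 2 * 19/20 apart.\<close>
    have sep: "dist (x i) (x j) \<ge> 19/10"
      if "i \<in> I" "j \<in> I" "i \<noteq> j" "dist y (x i) + dist y (x j) \<le> 34/5" for i j
    proof -
      have "dist y (midpoint (x i) (x j)) \<le> 17/5"
        using that(4) dist_midpoint_le[of y "x i" "x j"] by simp
      then have "dist (midpoint (x i) (x j)) (x i) > 19/20 \<or> dist (midpoint (x i) (x j)) (x j) > 19/20"
        using neg that(1-3) by blast
      then show ?thesis
        by (simp add: dist_midpoint)
    qed
    obtain i where i: "i \<in> I" "dist y (x i) < 21/20"
      using neg[of y] by auto
    obtain u :: 'a where u: "norm u = 1"
      using vector_choose_size[of 1] by auto
    \<comment> \<open>The point \<open>?q\<close> is just too far from \<open>x i\<close> to be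
      served by it, so the centre found near \<open>?q\<close> is a different one.\<close>
    let ?q = "x i + (21/20) *\<^sub>R u"
    have q: "dist ?q (x i) = 21/20"
      using u by (simp add: dist_norm)
    then have "dist y ?q \<le> 21/10"
      using i dist_triangle[of y ?q "x i"] by (simp add: dist_commute)
    then obtain j where j: "j \<in> I" "dist ?q (x j) < 21/20"
      using neg[of ?q] by auto
    have ij: "i \<noteq> j"
      using q j by force
    have yj: "dist y (x j) < 63/20"
      using \<open>dist y ?q \<le> 21/10\<close> j dist_triangle[of y "x j" ?q] by simp
    have dij: "dist (x i) (x j) \<ge> 19/10" "dist (x i) (x j) \<le> 21/10"
      using sep[OF i(1) j(1) ij] i yj dist_triangle[of "x i" "x j" ?q] q j
      by (simp_all add: dist_commute)
    let ?m = "midpoint (x i) (x j)"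
    obtain v0 where "v0 \<noteq> 0" "orthogonal (x i - x j) v0"
      using orthogonal_to_vector_exists[OF dim] by blast
    then obtain v :: 'a where v: "norm v = 1" "orthogonal (x i - x j) v"
      using that[of "v0 /\<^sub>R norm v0"] by (simp add: orthogonal_def)
    let ?p = "?m + (1/2) *\<^sub>R v"
    have pm: "dist ?p ?m = 1/2"
      using v by (simp add: dist_norm)
    have "dist ?p (x i) = dist ?p (x j)"
    proof -
      have eqs: "?p - x i = (1/2) *\<^sub>R (v - (x i - x j))" "?p - x j = (1/2) *\<^sub>R (v + (x i - x j))"
        by (simp_all add: midpoint_def algebra_simps flip: scaleR_left_distrib)
      have "norm (v - (x i - x j)) = norm (v + (x i - x j))"
        using v(2) unfolding norm_eq orthogonal_def
        by (simp add: inner_simps inner_commute)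
      then show ?thesis
        unfolding dist_norm eqs by simp
    qed
    \<comment> \<open>The right-hand side is 2.305. Both squared distances are equal, so each is at
      least 1.1525, above (21/20)^2 = 1.1025; hence neither \<open>x i\<close> nor
      \<open>x j\<close> is the centre found near \<open>?p\<close>.\<close>
    moreover have "(dist ?p (x i))\<^sup>2 + (dist ?p (x j))\<^sup>2 \<ge> 2 * (1/2)\<^sup>2 + (19/10)\<^sup>2 / 2"
      unfolding median_length pm using dij(1) by (simp add: power_mono)
    ultimately have pij: "(dist ?p (x i))\<^sup>2 \<ge> (21/20)\<^sup>2" "(dist ?p (x j))\<^sup>2 \<ge> (21/20)\<^sup>2"
      by (simp_all add: power2_eq_square)
    have ym: "dist y ?m < 21/10"
      using dist_midpoint_le[of y "x i" "x j"] i yj by simp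
    then have yp: "dist y ?p < 26/10"
      using pm dist_triangle[of y ?p ?m] by (simp add: dist_commute)
    then obtain k where k: "k \<in> I" "dist ?p (x k) < 21/20"
      using neg[of ?p] by auto
    then have "(dist ?p (x k))\<^sup>2 < (21/20)\<^sup>2"
      by (simp add: power_strict_mono)
    then have "k \<noteq> i" "k \<noteq> j"
      using pij leD by blast+
    have yk: "dist y (x k) < 73/20"
      using yp k dist_triangle[of y "x k" ?p] by simp
    \<comment> \<open>This is where 17/5 comes from: the bounds 73/20 for \<open>x k\<close> and
      63/20 for \<open>x j\<close> add up to 34/5, exactly the range of \<open>sep\<close>.\<close>
    have "dist (x k) (x i) \<ge> 19/10" "dist (x k) (x j) \<ge> 19/10"
      using sep[OF k(1) i(1) \<open>k \<noteq> i\<close>] sep[OF k(1) j(1) \<open>k \<noteq> j\<close>] i yj yk by auto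
    then have "(19/10)\<^sup>2 + (19/10)\<^sup>2 \<le> (dist (x k) (x i))\<^sup>2 + (dist (x k) (x j))\<^sup>2"
      by (intro add_mono power_mono) auto
    also have "\<dots> = 2 * (dist (x k) ?m)\<^sup>2 + (dist (x i) (x j))\<^sup>2 / 2"
      by (rule median_length)
    \<comment> \<open>Here 31/20 = 1/2 + 21/20. The left end of the chain is 7.22 and the right end
      7.01, a contradiction.\<close>
    also have "\<dots> \<le> 2 * (31/20)\<^sup>2 + (21/10)\<^sup>2 / 2"
    proof -
      have "dist (x k) ?m \<le> 31/20"
        using k pm dist_triangle[of "x k" ?m ?p] by (simp add: dist_commute)
      then show ?thesis
        using dij(2) by (intro add_mono mult_left_mono divide_right_mono power_mono) auto
    qed
    finally show False
      by (simp add: power2_eq_square)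
  qed
  then show thesis
    using that by (meson not_le)
qed

text \<open>Scaling by \<open>r\<close> reduces this to unit balls. The gap of 1/20 between the
  radius 1 and the thresholds 21/20 and 19/20 fattens the bad point to a ball of radius
  \<open>r/20\<close> that is entirely uncovered or entirely covered twice; it fits since 17/5 +
  1/20 < 7/2.\<close>

lemma balls_hole_or_overlap:
  fixes x :: "'i \<Rightarrow> 'a::euclidean_space" and y :: 'a
  assumes dim: "DIM('a) \<ge> 2" and r: "r > 0"
  obtains p where "ball p (r/20) \<subseteq> ball y (7/2 * r)"
    and "\<And>z. z \<in> ball p (r/20) \<Longrightarrow> \<not> (\<exists>!i. i \<in> I \<and> z \<in> ball (x i) r)"
proof -
  have scale: "dist (r *\<^sub>R a) b = r * dist a (b /\<^sub>R r)" for a b :: 'a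
  proof -
    have "r *\<^sub>R a - b = r *\<^sub>R (a - b /\<^sub>R r)"
      using r by (simp add: algebra_simps)
    then show ?thesis
      using r by (simp add: dist_norm)
  qed
  obtain q where q: "dist (y /\<^sub>R r) q \<le> 17/5"
    and alt: "(\<forall>i\<in>I. dist q (x i /\<^sub>R r) \<ge> 21/20) \<or>
      (\<exists>i\<in>I. \<exists>j\<in>I. i \<noteq> j \<and> dist q (x i /\<^sub>R r) \<le> 19/20 \<and> dist q (x j /\<^sub>R r) \<le> 19/20)"
    by (rule unit_balls_hole_or_overlap[OF dim, of "y /\<^sub>R r" I "\<lambda>i. x i /\<^sub>R r"])
  show thesis
  proof (rule that[of "r *\<^sub>R q"])
    have "dist y (r *\<^sub>R q) \<le> 17/5 * r"
      using q r scale[of q y] by (simp add: dist_commute mult.commute)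
    then show "ball (r *\<^sub>R q) (r/20) \<subseteq> ball y (7/2 * r)"
      using r by (simp add: ball_subset_ball_iff dist_commute)
  next
    fix z assume z: "z \<in> ball (r *\<^sub>R q) (r/20)"
    show "\<not> (\<exists>!i. i \<in> I \<and> z \<in> ball (x i) r)"
      using alt
    proof
      assume far: "\<forall>i\<in>I. dist q (x i /\<^sub>R r) \<ge> 21/20"
      have "z \<notin> ball (x i) r" if "i \<in> I" for i
      proof -
        have "dist (r *\<^sub>R q) (x i) \<ge> 21/20 * r"
          using far that r scale[of q "x i"] by (simp add: mult.commute)
        then show ?thesis
          using z dist_triangle[of "r *\<^sub>R q" "x i" z] by (simp add: dist_commute)
      qed
      then show ?thesis by blast
    next
      assume "\<exists>i\<in>I. \<exists>j\<in>I. i \<noteq> j \<and> dist q (x i /\<^sub>R r) \<le> 19/20 \<and> dist q (x j /\<^sub>R r) \<le> 19/20"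
      moreover have "z \<in> ball (x i) r" if "dist q (x i /\<^sub>R r) \<le> 19/20" for i
      proof -
        have "dist (r *\<^sub>R q) (x i) \<le> 19/20 * r"
          using that r scale[of q "x i"] by (simp add: mult.commute)
        then show ?thesis
          using z dist_triangle[of "x i" z "r *\<^sub>R q"] by (simp add: dist_commute)
      qed
      ultimately show ?thesis by blast
    qed
  qed
qed

section \<open>Vitali covering and the measure of the defect set\<close>

text \<open>Take a maximal disjoint subfamily of a finite cover by balls of radius \<open>s\<close>.
  By maximality every net point is within \<open>2 * s\<close> of a chosen centre, and every point
  of \<open>K\<close> is within \<open>s\<close> of the net, whence the factor 3.\<close>

lemma compact_Vitali_cover:
  fixes K :: "'a::metric_space set"
  assumes "compact K" and s: "s > 0"
  obtains F where "finite F" "F \<subseteq> K" "pairwise (\<lambda>a b. disjnt (ball a s) (ball b s)) F"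
    and "K \<subseteq> (\<Union>a\<in>F. ball a (3 * s))"
proof -
  obtain D where D: "D \<subseteq> K" "finite D" "K \<subseteq> (\<Union>a\<in>D. ball a s)"
    using compactE_image[OF \<open>compact K\<close>, of K "\<lambda>a. ball a s"] s
    by (metis UN_I centre_in_ball open_ball subsetI)
  define \<F> where "\<F> = {F. F \<subseteq> D \<and> pairwise (\<lambda>a b. disjnt (ball a s) (ball b s)) F}"
  have "finite \<F>" "{} \<in> \<F>"
    using D(2) by (auto simp: \<F>_def)
  then obtain F where F: "F \<in> \<F>" and max: "\<And>F'. F' \<in> \<F> \<Longrightarrow> F \<subseteq> F' \<Longrightarrow> F = F'"
    using finite_has_maximal[of \<F>] by blast
  have near: "\<exists>b\<in>F. dist b a < 2 * s" if a: "a \<in> D" for a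
  proof (cases "a \<in> F")
    case True
    then show ?thesis using s by (intro bexI[of _ a]) auto
  next
    case False
    then have "insert a F \<notin> \<F>"
      using max by blast
    then have "\<not> pairwise (\<lambda>a b. disjnt (ball a s) (ball b s)) (insert a F)"
      using F a by (simp add: \<F>_def)
    then obtain b where "b \<in> F" "ball a s \<inter> ball b s \<noteq> {}"
      using F unfolding \<F>_def pairwise_insert disjnt_def by blast
    then obtain z where "dist a z < s" "dist b z < s"
      by auto
    then have "dist b a < 2 * s"
      using dist_triangle[of b a z] by (simp add: dist_commute)
    then show ?thesis using \<open>b \<in> F\<close> by blast
  qed
  have "K \<subseteq> (\<Union>a\<in>F. ball a (3 * s))"
  proof -
    have "\<exists>b\<in>F. dist b z < 3 * s" if "z \<in> K" for z
    proof -
      obtain a where "a \<in> D" "dist a z < s"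
        using D(3) \<open>z \<in> K\<close> by auto
      moreover obtain b where "b \<in> F" "dist b a < 2 * s"
        using near[OF \<open>a \<in> D\<close>] by blast
      ultimately show ?thesis
        using dist_triangle[of b z a] by (intro bexI[of _ b]) auto
    qed
    then show ?thesis by auto
  qed
  then show thesis
    using that[of F] F D by (auto simp: \<F>_def dest: finite_subset)
qed

text \<open>
  The factor is \<open>210 = 3 * (7/2) / (1/20)\<close>: the tripled Vitali radius over the radius of a ball in \<open>G\<close>.
\<close>
lemma equal_balls_defect:
  fixes x :: "'i \<Rightarrow> 'a::euclidean_space" and K G :: "'a set"
  assumes dim: "DIM('a) \<ge> 2" and r: "r > 0" and "compact K"
    and KU: "\<And>y. y \<in> K \<Longrightarrow> ball y (7/2 * r) \<subseteq> U"
    and G: "G \<in> lmeasurable"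
    and once: "\<And>z. z \<in> U \<Longrightarrow> z \<notin> G \<Longrightarrow> \<exists>!i. i \<in> I \<and> z \<in> ball (x i) r"
  shows "lmeas K \<le> 210 ^ DIM('a) * lmeas G"
proof -
  define s where "s = 7/2 * r"
  have s: "s > 0" using r by (simp add: s_def)
  have "\<exists>p. ball p (r/20) \<subseteq> ball y s \<inter> G" if "y \<in> K" for y
  proof -
    obtain p where p: "ball p (r/20) \<subseteq> ball y (7/2 * r)"
      and bad: "\<And>z. z \<in> ball p (r/20) \<Longrightarrow> \<not> (\<exists>!i. i \<in> I \<and> z \<in> ball (x i) r)"
      by (rule balls_hole_or_overlap[OF dim r, of y I x]) blast
    have "ball p (r/20) \<subseteq> G"
      using bad once p KU[OF that] by (meson subset_iff)
    then show ?thesis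
      using p unfolding s_def by blast
  qed
  then obtain p where p: "\<And>y. y \<in> K \<Longrightarrow> ball (p y) (r/20) \<subseteq> ball y s \<inter> G"
    by metis
  obtain F where F: "finite F" "F \<subseteq> K" "pairwise (\<lambda>a b. disjnt (ball a s) (ball b s)) F"
    and cover: "K \<subseteq> (\<Union>a\<in>F. ball a (3 * s))"
    by (rule compact_Vitali_cover[OF \<open>compact K\<close> s])
  let ?w = "unit_ball_vol (DIM('a))"
  have "lmeas K \<le> lmeas (\<Union>a\<in>F. ball a (3 * s))"
    using cover F(1) fmeasurableD[OF lmeasurable_compact[OF \<open>compact K\<close>]]
    by (intro measure_mono_fmeasurable fmeasurable.finite_UN) auto
  also have "\<dots> \<le> (\<Sum>a\<in>F. lmeas (ball a (3 * s)))"
    using F(1) by (intro measure_UNION_le) auto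
  also have "\<dots> = card F * (?w * (3 * s) ^ DIM('a))"
    using s by (simp add: content_ball)
  also have "\<dots> = 210 ^ DIM('a) * (card F * (?w * (r / 20) ^ DIM('a)))"
  proof -
    have "(3 * s) ^ DIM('a) = (210 * (r / 20)) ^ DIM('a)"
      by (simp add: s_def)
    then show ?thesis
      by (simp only: power_mult_distrib mult_ac)
  qed
  also have "card F * (?w * (r / 20) ^ DIM('a)) = (\<Sum>a\<in>F. lmeas (ball (p a) (r/20)))"
    using r by (simp add: content_ball)
  \<comment> \<open>The small balls lie in the disjoint balls \<open>ball a s\<close>, so their
    volumes add up inside \<open>G\<close>.\<close>
  also have "\<dots> = lmeas (\<Union>a\<in>F. ball (p a) (r/20))"
  proof (rule measure_UNION'[symmetric])
    show "pairwise (\<lambda>a b. disjnt (ball (p a) (r/20)) (ball (p b) (r/20))) F"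
    proof (rule pairwiseI)
      fix a b assume "a \<in> F" "b \<in> F" "a \<noteq> b"
      then have "disjnt (ball a s) (ball b s)" and "ball (p a) (r/20) \<subseteq> ball a s"
        and "ball (p b) (r/20) \<subseteq> ball b s"
        using F(2,3) p unfolding pairwise_def by blast+
      then show "disjnt (ball (p a) (r/20)) (ball (p b) (r/20))"
        by (meson disjnt_subset1 disjnt_subset2)
    qed
  qed (use F(1) in auto)
  also have "\<dots> \<le> lmeas G"
  proof (rule measure_mono_fmeasurable[OF _ _ G])
    show "(\<Union>a\<in>F. ball (p a) (r/20)) \<subseteq> G"
      using F(2) p by blast
  qed (use F(1) in auto)
  finally show ?thesis by simp
qed

section \<open>Nearly optimal balls and the cost of shrinking them\<close>

lemma exists_radius_of_volume:
  fixes v :: real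
  assumes "v > 0"
  obtains r where "r > 0" "\<And>c::'a::euclidean_space. lmeas (ball c r) = v"
proof
  let ?w = "unit_ball_vol (DIM('a))"
  let ?r = "root DIM('a) (v / ?w)"
  have "?w \<noteq> 0"
    using unit_ball_vol_pos[of "DIM('a)"] by linarith
  show "?r > 0"
    using assms by simp
  then show "lmeas (ball c ?r) = v" for c :: 'a
    using assms \<open>?w \<noteq> 0\<close> by (simp add: content_ball less_imp_le)
qed

text \<open>A ball attaining the infimum is avoided by allowing an error. It is weighted by
  \<open>lmeas E\<close>, so that over a partition the errors sum to \<open>lmeas U * e\<close>,
  whatever the number of cells.\<close>

lemma fraenkel_asymmetry_approx:
  fixes E :: "'a::euclidean_space set"
  assumes "lmeas E > 0" "e > 0"
  obtains x r where "r > 0" "lmeas (ball x r) = lmeas E"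
    "lmeas ((E - ball x r) \<union> (ball x r - E)) \<le> lmeas E * fraenkel_asymmetry E + lmeas E * e"
proof -
  let ?S = "{ lmeas ((E - B) \<union> (B - E)) / lmeas E | B.
           (\<exists>x r. r > 0 \<and> B = ball x r) \<and> lmeas B = lmeas E }"
  obtain r where r: "r > 0" "\<And>c::'a. lmeas (ball c r) = lmeas E"
    by (rule exists_radius_of_volume[OF assms(1)]) blast
  have "?S \<noteq> {}"
    using r by blast
  moreover have "Inf ?S < fraenkel_asymmetry E + e"
    using \<open>e > 0\<close> by (simp add: fraenkel_asymmetry_def)
  ultimately obtain q where q: "q \<in> ?S" "q < fraenkel_asymmetry E + e"
    by (rule bexE[OF cInf_lessD])
  then obtain x r where x: "r > 0" "lmeas (ball x r) = lmeas E"
    "q = lmeas ((E - ball x r) \<union> (ball x r - E)) / lmeas E"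
    unfolding mem_Collect_eq by blast
  have "lmeas ((E - ball x r) \<union> (ball x r - E)) = lmeas E * q"
    unfolding x(3) using assms by simp
  also have "\<dots> \<le> lmeas E * (fraenkel_asymmetry E + e)"
    using q assms by (intro mult_left_mono) auto
  finally show thesis
    using that[OF x(1,2)] by (simp add: distrib_left)
qed

text \<open>Triangle inequality for symmetric differences: the concentric balls are nested, so they
  differ by exactly the difference of their volumes.\<close>

lemma lmeas_symdiff_shrink:
  fixes E :: "'a::euclidean_space set"
  assumes "E \<in> lmeasurable" "r > 0" "lmeas (ball x r) \<le> lmeas (ball x R)"
  shows "lmeas ((E - ball x r) \<union> (ball x r - E))
    \<le> lmeas ((E - ball x R) \<union> (ball x R - E)) + (lmeas (ball x R) - lmeas (ball x r))"
proof -
  have "R > 0"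
    using assms by (metis content_ball_gt_0_iff measure_completion less_le_trans borel_open open_ball sets_lborel)
  then have "r \<le> R"
    using assms unit_ball_vol_pos[of "DIM('a)"] by (simp add: content_ball)
  then have sub: "ball x r \<subseteq> ball x R"
    by (rule subset_ball)
  have "lmeas ((E - ball x r) \<union> (ball x r - E))
      \<le> lmeas (((E - ball x R) \<union> (ball x R - E)) \<union> (ball x R - ball x r))"
    using fmeasurableD[OF assms(1)] assms(1) sub
    by (intro measure_mono_fmeasurable sets.Un sets.Diff fmeasurable.Un fmeasurable_Diff) auto
  also have "\<dots> \<le> lmeas ((E - ball x R) \<union> (ball x R - E)) + lmeas (ball x R - ball x r)"
    using fmeasurableD[OF assms(1)] by (intro measure_Un_le sets.Un sets.Diff) auto
  also have "lmeas (ball x R - ball x r) = lmeas (ball x R) - lmeas (ball x r)"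
    using sub by (intro measurable_measure_Diff) auto
  finally show ?thesis .
qed

section \<open>From the defect estimate to partitions\<close>

text \<open>The hypothesis \<open>small\<close> forces the smallest cell to have the volume of a
  ball of radius \<open>r < 2/7 * d\<close>, so the balls of radius \<open>7/2 * r\<close> around
  points of \<open>K\<close> stay inside \<open>U\<close>.\<close>

lemma partition_lower_bound:
  fixes U K :: "'a::euclidean_space set"
  assumes dim: "DIM('a) \<ge> 2" and U: "bounded U"
    and K: "compact K" "\<And>y. y \<in> K \<Longrightarrow> ball y d \<subseteq> U" and d: "d > 0"
    and part: "is_partition U N \<Omega>" and N: "N \<ge> 1"
    and small: "lmeas U < N * lmeas (ball (0::'a) (2/7 * d))"
  shows "lmeas K \<le> 210 ^ DIM('a) *
    ((\<Sum>i=1..N. lmeas (\<Omega> i) * fraenkel_asymmetry (\<Omega> i))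
     + (\<Sum>i=1..N. lmeas (\<Omega> i) * deviation_min \<Omega> N i))"
proof -
  have UN: "U = (\<Union>i\<in>{1..N}. \<Omega> i)"
    and pos: "\<And>i. i \<in> {1..N} \<Longrightarrow> lmeas (\<Omega> i) > 0"
    and disj: "\<And>i j. i \<in> {1..N} \<Longrightarrow> j \<in> {1..N} \<Longrightarrow> i \<noteq> j \<Longrightarrow> \<Omega> i \<inter> \<Omega> j = {}"
    using part unfolding is_partition_def by blast+
  have lm: "\<Omega> i \<in> lmeasurable" if "i \<in> {1..N}" for i
  proof (rule bounded_set_imp_lmeasurable)
    show "bounded (\<Omega> i)"
      using U UN that by (meson UN_upper bounded_subset)
    show "\<Omega> i \<in> sets lebesgue"
      using part that unfolding is_partition_def by blast
  qed
  define m where "m = Min ((\<lambda>j. lmeas (\<Omega> j)) ` {1..N})"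
  have m_le: "m \<le> lmeas (\<Omega> i)" if "i \<in> {1..N}" for i
    using that unfolding m_def by (intro Min_le) auto
  have "m > 0"
    using N pos unfolding m_def by (subst Min_gr_iff) auto
  then obtain r where r: "r > 0" "\<And>c::'a. lmeas (ball c r) = m"
    by (rule exists_radius_of_volume) blast
  have sumU: "lmeas U = (\<Sum>i=1..N. lmeas (\<Omega> i))"
    unfolding UN using disj lm by (intro measure_UNION') (auto simp: pairwise_def disjnt_def)
  have "real N * m \<le> lmeas U"
    unfolding sumU using m_le sum_bounded_below[of "{1..N}" m "\<lambda>i. lmeas (\<Omega> i)"] by simp
  with small have "m < lmeas (ball (0::'a) (2/7 * d))"
    using N by (smt (verit) mult_left_mono of_nat_0_le_iff)
  then have "r ^ DIM('a) < (2/7 * d) ^ DIM('a)"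
    using r(2)[of 0, symmetric] r(1) d unit_ball_vol_pos[of "DIM('a)"] by (simp add: content_ball)
  then have "7/2 * r < d"
    using power_less_imp_less_base[of r "DIM('a)" "2/7 * d"] d by simp
  then have KU: "ball y (7/2 * r) \<subseteq> U" if "y \<in> K" for y
    using K(2)[OF that] subset_ball[of "7/2 * r" d y] by simp
  let ?A = "\<Sum>i=1..N. lmeas (\<Omega> i) * fraenkel_asymmetry (\<Omega> i)"
  let ?D = "\<Sum>i=1..N. lmeas (\<Omega> i) * deviation_min \<Omega> N i"
  \<comment> \<open>The denominator of the deviation cancels, leaving the volume lost when each ball
    is shrunk to volume \<open>m\<close>.\<close>
  have D: "?D = (\<Sum>i=1..N. lmeas (\<Omega> i) - m)"
    using pos by (intro sum.cong) (force simp: deviation_min_def m_def)+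
  have approx: "lmeas K \<le> 210 ^ DIM('a) * (?A + ?D + lmeas U * e)" if "e > 0" for e
  proof -
    have "\<exists>x R. lmeas (ball x R) = lmeas (\<Omega> i) \<and>
        lmeas ((\<Omega> i - ball x R) \<union> (ball x R - \<Omega> i))
          \<le> lmeas (\<Omega> i) * fraenkel_asymmetry (\<Omega> i) + lmeas (\<Omega> i) * e"
      if "i \<in> {1..N}" for i
      using fraenkel_asymmetry_approx[OF pos[OF that] \<open>e > 0\<close>] by metis
    then obtain x R where xR: "\<And>i. i \<in> {1..N} \<Longrightarrow> lmeas (ball (x i) (R i)) = lmeas (\<Omega> i)"
      "\<And>i. i \<in> {1..N} \<Longrightarrow> lmeas ((\<Omega> i - ball (x i) (R i)) \<union> (ball (x i) (R i) - \<Omega> i))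
          \<le> lmeas (\<Omega> i) * fraenkel_asymmetry (\<Omega> i) + lmeas (\<Omega> i) * e"
      by metis
    let ?G = "\<lambda>i. (\<Omega> i - ball (x i) r) \<union> (ball (x i) r - \<Omega> i)"
    have Gm: "?G i \<in> lmeasurable" if "i \<in> {1..N}" for i
      using lm[OF that] by (intro fmeasurable.Un fmeasurable_Diff) auto
    have "lmeas K \<le> 210 ^ DIM('a) * lmeas (\<Union>i\<in>{1..N}. ?G i)"
    proof (rule equal_balls_defect[OF dim r(1) K(1) KU])
      show "(\<Union>i\<in>{1..N}. ?G i) \<in> lmeasurable"
        using Gm by (intro fmeasurable.finite_UN) auto
    next
      fix z assume z: "z \<in> U" "z \<notin> (\<Union>i\<in>{1..N}. ?G i)"
      obtain i where i: "i \<in> {1..N}" "z \<in> \<Omega> i"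
        using z UN by blast
      \<comment> \<open>Outside every \<open>?G i\<close>, membership in a cell and in its shrunken
        ball agree, so disjointness of the cells gives uniqueness.\<close>
      show "\<exists>!i. i \<in> {1..N} \<and> z \<in> ball (x i) r"
      proof (intro ex1I[of _ i] conjI)
        show "z \<in> ball (x i) r"
          using z(2) i by blast
        show "j = i" if "j \<in> {1..N} \<and> z \<in> ball (x j) r" for j
          using that z(2) i disj[of i j] by blast
      qed (rule i(1))
    qed
    also have "lmeas (\<Union>i\<in>{1..N}. ?G i) \<le> (\<Sum>i=1..N. lmeas (?G i))"
      using Gm by (intro measure_UNION_le) (auto dest: fmeasurableD)
    also have "\<dots> \<le> (\<Sum>i=1..N. (lmeas (\<Omega> i) * fraenkel_asymmetry (\<Omega> i) + lmeas (\<Omega> i) * e)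
        + (lmeas (\<Omega> i) - m))"
    proof (rule sum_mono)
      fix i assume i: "i \<in> {1..N}"
      show "lmeas (?G i) \<le> (lmeas (\<Omega> i) * fraenkel_asymmetry (\<Omega> i) + lmeas (\<Omega> i) * e)
          + (lmeas (\<Omega> i) - m)"
        using lmeas_symdiff_shrink[OF lm[OF i] r(1), of "x i" "R i"] xR[OF i] m_le[OF i] r(2)
        by simp
    qed
    also have "\<dots> = ?A + ?D + lmeas U * e"
      unfolding D sumU by (simp add: sum.distrib sum_distrib_right)
    finally show ?thesis by simp
  qed
  show ?thesis
  proof (rule field_le_epsilon)
    fix e :: real assume "e > 0"
    \<comment> \<open>Chosen so that an approximation error of \<open>e / ?c\<close> costs at most
      \<open>e\<close> in total; the \<open>+ 1\<close> makes \<open>?c\<close> visibly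
      positive.\<close>
    let ?c = "210 ^ DIM('a) * (lmeas U + 1)"
    have "?c > 0" by (simp add: add_nonneg_pos)
    have "lmeas K \<le> 210 ^ DIM('a) * (?A + ?D + lmeas U * (e / ?c))"
      using \<open>e > 0\<close> \<open>?c > 0\<close> by (intro approx) simp
    also have "\<dots> = 210 ^ DIM('a) * (?A + ?D) + e * (lmeas U / (lmeas U + 1))"
    proof -
      have "lmeas U * (e / ?c) = e * (lmeas U / (lmeas U + 1)) / 210 ^ DIM('a)"
        by (simp only: divide_divide_eq_left times_divide_eq_right mult_ac)
      then show ?thesis
        by (simp only: distrib_left) simp
    qed
    also have "e * (lmeas U / (lmeas U + 1)) \<le> e * 1"
      using \<open>e > 0\<close> by (intro mult_left_mono) (auto simp: divide_le_eq add_nonneg_pos)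
    finally show "lmeas K \<le> 210 ^ DIM('a) * (?A + ?D) + e" by simp
  qed
qed

section \<open>Choice of the threshold \<open>N0\<close> and of the constants\<close>

lemma inner_compact_lmeas:
  fixes U :: "'a::euclidean_space set"
  assumes "open U" "bounded U" "e > 0"
  obtains K where "compact K" "K \<subseteq> U" "lmeas U - e \<le> lmeas K"
proof -
  have U: "U \<in> lmeasurable"
    using assms by (simp add: lmeasurable_open)
  obtain K where K: "closed K" "K \<subseteq> U" "U - K \<in> lmeasurable" "emeasure lebesgue (U - K) < ennreal e"
    using sets_lebesgue_inner_closed[of U e] U \<open>e > 0\<close> by (metis fmeasurableD)
  have "compact K"
    using K assms bounded_subset compact_eq_bounded_closed by blast
  moreover have "lmeas U - lmeas K \<le> e"
  proof -
    have "lmeas (U - K) = lmeas U - lmeas K"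
      using K U \<open>compact K\<close> by (intro measurable_measure_Diff) auto
    moreover have "lmeas (U - K) < e"
      using K(3,4) \<open>e > 0\<close> by (simp add: emeasure_eq_measure2 ennreal_less_iff)
    ultimately show ?thesis by simp
  qed
  ultimately show thesis
    using that[of K] K by simp
qed

lemma asym_dev_bound_DIM:
  assumes dim: "DIM('a::euclidean_space) \<ge> 2"
  shows "asym_dev_bound TYPE('a) ((3/4) / 210 ^ DIM('a))"
  unfolding asym_dev_bound_def
proof (intro allI impI)
  fix U :: "'a set" assume U: "open U \<and> bounded U"
  have U_lm: "U \<in> lmeasurable"
    using U by (simp add: lmeasurable_open)
  let ?S = "\<lambda>N \<Omega>. (\<Sum>i=1..N. lmeas (\<Omega> i) / lmeas U * fraenkel_asymmetry (\<Omega> i))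
         + (\<Sum>i=1..N. lmeas (\<Omega> i) / lmeas U * deviation_min \<Omega> N i)"
  show "\<exists>N0::nat. \<forall>N \<ge> N0. \<forall>\<Omega>. is_partition U N \<Omega> \<longrightarrow> ?S N \<Omega> \<ge> (3/4) / 210 ^ DIM('a)"
  proof (cases "U = {}")
    case True
    \<comment> \<open>The empty set has the void partition with \<open>N = 0\<close>, so the
      threshold here is 1.\<close>
    have "\<not> is_partition U N \<Omega>" if "N \<ge> 1" for N \<Omega>
      using that True unfolding is_partition_def by force
    then show ?thesis by blast
  next
    case False
    then have "lmeas U \<noteq> 0"
      using open_not_negligible[of U] negligible_iff_measure0[OF U_lm] U by blast
    then have posU: "lmeas U > 0"
      by (metis measure_nonneg order_less_le)
    \<comment> \<open>Keeping three quarters of the measure suffices for the planar constant: (3/4)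
      / 210^2 = 1/58800, slightly more than 1/60000.\<close>
    obtain K where K: "compact K" "K \<subseteq> U" "lmeas U - lmeas U / 4 \<le> lmeas K"
      using inner_compact_lmeas[of U "lmeas U / 4"] U posU by auto
    obtain d where d: "d > 0" "(\<Union>y\<in>K. ball y d) \<subseteq> U"
      using compact_subset_open_imp_ball_epsilon_subset[OF K(1) _ K(2)] U by blast
    let ?v = "lmeas (ball (0::'a) (2/7 * d))"
    have "?v > 0"
      using d by (simp add: content_ball)
    then obtain M :: nat where M: "lmeas U < M * ?v"
      using reals_Archimedean3 by blast
    show ?thesis
    \<comment> \<open>\<open>M\<close> makes the average cell small compared with the fixed margin
      \<open>d\<close>; the 1 ensures that there is a smallest cell.\<close>
    proof (intro exI[of _ "max 1 M"] allI impI)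
      fix N \<Omega> assume N: "N \<ge> max 1 M" and part: "is_partition U N \<Omega>"
      have "M * ?v \<le> N * ?v"
        using N \<open>?v > 0\<close> by (intro mult_right_mono) auto
      with M have "lmeas U < N * ?v" by simp
      then have "lmeas K \<le> 210 ^ DIM('a) *
        ((\<Sum>i=1..N. lmeas (\<Omega> i) * fraenkel_asymmetry (\<Omega> i))
          + (\<Sum>i=1..N. lmeas (\<Omega> i) * deviation_min \<Omega> N i))"
        using U K(1) d N part by (intro partition_lower_bound[OF dim]) auto
      also have "\<dots> = 210 ^ DIM('a) * (lmeas U * ?S N \<Omega>)"
        using posU by (simp add: sum_distrib_left distrib_left)
      finally have "lmeas U * (3/4) \<le> lmeas U * (210 ^ DIM('a) * ?S N \<Omega>)"
        using K(3) by (simp add: mult_ac)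
      then have "3/4 \<le> 210 ^ DIM('a) * ?S N \<Omega>"
        using posU by (simp only: mult_le_cancel_left_pos)
      then show "?S N \<Omega> \<ge> (3/4) / 210 ^ DIM('a)"
        by (simp add: divide_le_eq mult.commute)
    qed
  qed
qed

lemma asym_dev_bound_mono:
  "asym_dev_bound T c \<Longrightarrow> c' \<le> c \<Longrightarrow> asym_dev_bound T c'"
  unfolding asym_dev_bound_def by (meson order_trans)

theorem theorem1:
  assumes "CARD('n::finite) \<ge> 2"
  shows "(\<exists>c > 0. asym_dev_bound TYPE(real ^ 'n) c)
         \<and> asym_dev_bound TYPE(real ^ 2) (1 / 60000)"
proof
  show "\<exists>c > 0. asym_dev_bound TYPE(real ^ 'n) c"
    using asym_dev_bound_DIM[where 'a = "real ^ 'n"] assms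
    by (intro exI[of _ "(3/4) / 210 ^ CARD('n)"]) simp
  have "asym_dev_bound TYPE(real ^ 2) ((3/4) / 210 ^ 2)"
    using asym_dev_bound_DIM[where 'a = "real ^ 2"] by simp
  then show "asym_dev_bound TYPE(real ^ 2) (1 / 60000)"
    by (rule asym_dev_bound_mono) simp
qed

end
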